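(* Let $F$ be a field of characteristic $0$, and let $H=\langle1,c,b,cb\rangle_F$ be the $4$-dimensional Sweedler Hopf algebra, considered as an algebra with the action of its dual Hopf algebra $H^*$ given by $gh=g(h_{(2)})h_{(1)}$, $h\in H$, $g\in H^*$. Then there exist $C>0$ and $r\in\mathbb{R}$ such that $$Cn^r4^n\leqslant c_n^{H^*}(H)\leqslant4^{n+1}\quad\text{for all } n\in\mathbb{N}.$$
   Context: $\mathbb{N}=\{1,2,\dots\}$. In Sweedler's algebra $H$: $c^2=1$, $b^2=0$, $bc=-cb$, $\Delta(c)=c\otimes c$, $\Delta(b)=c\otimes b+b\otimes1$, $\varepsilon(c)=1$, $\varepsilon(b)=0$, $S(c)=c$, $S(b)=-cb$. Sweedler's notation $\Delta h=h_{(1)}\otimes h_{(2)}$ is used. For a Hopf algebra $K$ with basis $(\gamma_\beta)_{\beta\in\Lambda}$ and a $K$-module algebra $A$ (here $K=H^*$, $A=H$): $F\langle X|K\rangle$ is the free associative algebra over $F$ with free formal generators $x_i^{\gamma_\beta}$, $\beta\in\Lambda$, $i\in\mathbb{N}$; for $k=\sum_\beta\alpha_\beta\gamma_\beta$ put $x_i^k:=\sum_\beta\alpha_\beta x_i^{\gamma_\beta}$, and $x_i:=x_i^1$. An element $f(x_1,\dots,x_n)\in F\langle X|K\rangle$ is evaluated at $a_1,\dots,a_n\in A$ by substituting $ka_i$ for $x_i^k$. It is a $K$-identity of $A$ if $f(a_1,\dots,a_n)=0$ for all $a_i\in A$; $\mathrm{Id}^K(A)$ is the set of $K$-identities. Let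 $$P_n^K=\langle x^{k_1}_{\sigma(1)}x^{k_2}_{\sigma(2)}\cdots x^{k_n}_{\sigma(n)}\mid k_i\in K,\ \sigma\in S_n\rangle_F\subset F\langle X|K\rangle,$$ and $c_n^K(A):=\dim\bigl(P_n^K/(P_n^K\cap\mathrm{Id}^K(A))\bigr)$. *)

theory Defs
  imports Complex_Main "HOL-Library.Poly_Mapping" "HOL-Library.Function_Algebras"
    "HOL-Combinatorics.Permutations"
begin

section \<open>Dimension of a quotient space\<close>

locale vector_space_quotient = vector_space scale
  for scale :: "'a::field \<Rightarrow> 'b::ab_group_add \<Rightarrow> 'b" (infixr "*s" 75)
begin

text \<open>\<open>B\<close> is a system of representatives of a basis of \<open>V / U\<close>: the cosets of its elements are
  linearly independent (a linear combination of them is the zero coset iff the same combination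
  of representatives lies in \<open>U\<close>) and span \<open>V / U\<close>.  As for \<^term>\<open>dim\<close>, the dimension is
  the cardinality of an arbitrary basis, hence 0 in the infinite-dimensional case.\<close>

definition quotient_basis :: "'b set \<Rightarrow> 'b set \<Rightarrow> 'b set \<Rightarrow> bool" where
  "quotient_basis V U B \<longleftrightarrow>
     B \<subseteq> V \<and>
     (\<forall>t\<subseteq>B. finite t \<longrightarrow> (\<forall>r. (\<Sum>v\<in>t. scale (r v) v) \<in> U \<longrightarrow> (\<forall>v\<in>t. r v = 0))) \<and>
     (\<forall>v\<in>V. \<exists>w\<in>span B. v - w \<in> U)"

definition quotient_dim :: "'b set \<Rightarrow> 'b set \<Rightarrow> nat" where
  "quotient_dim V U = card (SOME B. quotient_basis V U B)"

lemma quotient_basis_exists: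
  assumes "subspace U" "subspace V" "U \<subseteq> V"
  shows "\<exists>B. quotient_basis V U B"
proof -
  obtain C where C: "C \<subseteq> U" "independent C" "U \<subseteq> span C"
    using maximal_independent_subset by blast
  obtain D where D: "C \<subseteq> D" "D \<subseteq> V" "independent D" "V \<subseteq> span D"
    using maximal_independent_subset_extend[OF order_trans[OF C(1) assms(3)] C(2)] by metis
  have sC: "span C = U" using C assms(1) span_minimal by blast
  have int: "x = 0" if x: "x \<in> span (D - C)" "x \<in> U" for x
  proof -
    have rep: "representation D x = representation C x"
      by (rule representation_extend[OF D(3) _ D(1)]) (simp add: sC x)
    have rep': "representation D x = representation (D - C) x"
      by (rule representation_extend[OF D(3) x(1) Diff_subset])
    have xD: "x \<in> span D"
      using x(1) span_mono[OF Diff_subset] by (rule set_rev_mp)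
    have "representation D x b = 0" for b
    proof (rule ccontr)
      assume nz: "representation D x b \<noteq> 0"
      have "b \<in> C" by (rule representation_ne_zero[of C x]) (use nz rep in simp)
      moreover have "b \<in> D - C" by (rule representation_ne_zero[of "D - C" x]) (use nz rep' in simp)
      ultimately show False by simp
    qed
    then show ?thesis
      using sum_nonzero_representation_eq[OF D(3) xD] by simp
  qed
  have "quotient_basis V U (D - C)"
    unfolding quotient_basis_def
  proof (intro conjI allI impI ballI)
    show "D - C \<subseteq> V" using D by blast
  next
    fix t r v assume t: "t \<subseteq> D - C" "finite t" "(\<Sum>v\<in>t. scale (r v) v) \<in> U" "v \<in> t"
    have "(\<Sum>v\<in>t. scale (r v) v) \<in> span (D - C)"
      using t by (intro span_sum span_scale span_base) auto
    then have "(\<Sum>v\<in>t. scale (r v) v) = 0" using int t(3) by simp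
    then show "r v = 0" using independentD[OF D(3) t(2) _ _ t(4)] t(1) by auto
  next
    fix v assume "v \<in> V"
    moreover have "(D - C) \<union> C = D" using D(1) by blast
    ultimately have "v \<in> span ((D - C) \<union> C)" using D(4) by auto
    then obtain x y where "v = x + y" "x \<in> span (D - C)" "y \<in> span C"
      unfolding span_Un by blast
    then show "\<exists>w\<in>span (D - C). v - w \<in> U" using sC by (intro bexI[of _ x]) auto
  qed
  then show ?thesis by blast
qed

text \<open>In the finite-dimensional case the chosen basis is immaterial.\<close>

lemma card_quotient_basis:
  assumes "subspace U" "subspace V" "U \<subseteq> V" "finite S" "V \<subseteq> span S" "quotient_basis V U B"
  shows "card B + dim U = dim V"
proof -
  obtain C where C: "C \<subseteq> U" "independent C" "U \<subseteq> span C" "card C = dim U"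
    using basis_exists by blast
  have sC: "span C = U" using C assms(1) span_minimal by blast
  have BV: "B \<subseteq> V" and lin: "\<And>t r v. t \<subseteq> B \<Longrightarrow> finite t \<Longrightarrow>
      (\<Sum>v\<in>t. scale (r v) v) \<in> U \<Longrightarrow> v \<in> t \<Longrightarrow> r v = 0"
    and spn: "\<And>v. v \<in> V \<Longrightarrow> \<exists>w\<in>span B. v - w \<in> U"
    using assms(6) unfolding quotient_basis_def by blast+
  have disj: "B \<inter> C = {}"
  proof (rule ccontr)
    assume "B \<inter> C \<noteq> {}"
    then obtain x where "x \<in> B" "x \<in> C" by blast
    then show False using lin[of "{x}" "\<lambda>_. 1" x] C by auto
  qed
  have ind: "independent (B \<union> C)"
    unfolding independent_explicit_module
  proof (intro allI impI)
    fix t u v assume t: "finite t" "t \<subseteq> B \<union> C" "(\<Sum>v\<in>t. scale (u v) v) = 0" "v \<in> t"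
    have "(\<Sum>v\<in>t. scale (u v) v) =
        (\<Sum>v\<in>t \<inter> B. scale (u v) v) + (\<Sum>v\<in>t - B. scale (u v) v)"
      using t(1) by (metis sum.Int_Diff)
    then have eq: "(\<Sum>v\<in>t \<inter> B. scale (u v) v) = - (\<Sum>v\<in>t - B. scale (u v) v)"
      using t(3) by (simp add: eq_neg_iff_add_eq_0)
    have tC: "t - B \<subseteq> C" using t by blast
    have "(\<Sum>v\<in>t - B. scale (u v) v) \<in> U"
    proof (rule subspace_sum[OF assms(1)])
      fix v assume "v \<in> t - B"
      then have "v \<in> U" using tC C(1) by blast
      then show "scale (u v) v \<in> U" by (rule subspace_scale[OF assms(1)])
    qed
    then have inU: "(\<Sum>v\<in>t \<inter> B. scale (u v) v) \<in> U"
      unfolding eq by (rule subspace_neg[OF assms(1)])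
    have zB: "u v = 0" if "v \<in> t \<inter> B" for v
      by (rule lin[OF _ _ inU that]) (use t(1) in blast)+
    have "(\<Sum>v\<in>t \<inter> B. scale (u v) v) = 0"
      by (rule sum.neutral) (simp add: zB)
    then have "(\<Sum>v\<in>t - B. scale (u v) v) = 0"
      using eq by simp
    then have "\<And>v. v \<in> t - B \<Longrightarrow> u v = 0"
      using independentD[OF C(2) _ tC] t(1) by blast
    with zB t(4) show "u v = 0" by blast
  qed
  have "V \<subseteq> span (B \<union> C)"
  proof
    fix v assume "v \<in> V"
    then obtain w where w: "w \<in> span B" "v - w \<in> span C" using spn sC by blast
    then have "w + (v - w) \<in> span (B \<union> C)" unfolding span_Un by blast
    then show "v \<in> span (B \<union> C)" by simp
  qed
  moreover have sub: "B \<union> C \<subseteq> V"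
    using BV C(1) assms(3) by simp
  ultimately have "card (B \<union> C) = dim V"
    using basis_card_eq_dim[OF sub _ ind] by simp
  moreover have "finite (B \<union> C)"
    using independent_span_bound[OF assms(4) ind order_trans[OF sub assms(5)]] by (rule conjunct1)
  ultimately show ?thesis using disj C(4) by (simp add: card_Un_disjoint)
qed

lemma quotient_dim_eq:
  assumes "subspace U" "subspace V" "U \<subseteq> V" "finite S" "V \<subseteq> span S"
  shows "quotient_dim V U + dim U = dim V"
  unfolding quotient_dim_def
  using card_quotient_basis[OF assms] someI_ex[OF quotient_basis_exists[OF assms(1-3)]] by blast

end


section \<open>Sweedler's algebra\<close>

text \<open>\<open>Sw p q r s\<close> stands for \<open>p 1 + q c + r b + s cb\<close>.  Over a field \<open>'f\<close> this is Sweedler's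
  algebra \<open>H\<close>.  The coefficients may come from any ring \<open>'a\<close>, which gives the algebra
  \<open>'a \<otimes> H\<close>; thus \<open>'f sweedler sweedler\<close> is the algebra \<open>H \<otimes> H\<close>, an element
  \<open>Sw u v w z\<close> of it being \<open>u \<otimes> 1 + v \<otimes> c + w \<otimes> b + z \<otimes> cb\<close>.\<close>

datatype 'a sweedler = Sw (co_1: 'a) (co_c: 'a) (co_b: 'a) (co_cb: 'a)

instantiation sweedler :: (ring_1) ring_1
begin
definition "0 = Sw 0 0 0 0"
definition "1 = Sw 1 0 0 0"
fun plus_sweedler :: "'a sweedler \<Rightarrow> 'a sweedler \<Rightarrow> 'a sweedler" where
  "Sw p q r s + Sw p' q' r' s' = Sw (p + p') (q + q') (r + r') (s + s')"
fun minus_sweedler :: "'a sweedler \<Rightarrow> 'a sweedler \<Rightarrow> 'a sweedler" where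
  "Sw p q r s - Sw p' q' r' s' = Sw (p - p') (q - q') (r - r') (s - s')"
fun uminus_sweedler :: "'a sweedler \<Rightarrow> 'a sweedler" where
  "- Sw p q r s = Sw (- p) (- q) (- r) (- s)"
fun times_sweedler :: "'a sweedler \<Rightarrow> 'a sweedler \<Rightarrow> 'a sweedler" where
  "Sw p q r s * Sw p' q' r' s' =
     Sw (p * p' + q * q')
        (p * q' + q * p')
        (p * r' + q * s' + r * p' - s * q')
        (p * s' + q * r' - r * q' + s * p')"
instance
proof
  fix x y z :: "'a sweedler"
  show "x * y * z = x * (y * z)"
    by (cases x; cases y; cases z) (simp add: algebra_simps)
  show "(x + y) * z = x * z + y * z" "x * (y + z) = x * y + x * z" "x + y + z = x + (y + z)"
    by (cases x; cases y; cases z; simp add: algebra_simps)+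
  show "1 * x = x" "x * 1 = x" "0 + x = x" "- x + x = 0"
    by (cases x; simp add: zero_sweedler_def one_sweedler_def)+
  show "x + y = y + x" "x - y = x + - y"
    by (cases x; cases y; simp add: add.commute)+
  show "(0 :: 'a sweedler) \<noteq> 1"
    by (simp add: zero_sweedler_def one_sweedler_def)
qed
end

definition sw_c :: "'a::ring_1 sweedler" where "sw_c = Sw 0 1 0 0"
definition sw_b :: "'a::ring_1 sweedler" where "sw_b = Sw 0 0 1 0"

definition sw_scale :: "'a::ring_1 \<Rightarrow> 'a sweedler \<Rightarrow> 'a sweedler" where
  "sw_scale t x = map_sweedler ((*) t) x"

lemmas sw_defs = zero_sweedler_def one_sweedler_def sw_c_def sw_b_def sw_scale_def

lemma sweedler_relations:
  "sw_c * sw_c = (1 :: 'a::ring_1 sweedler)"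
  "sw_b * sw_b = (0 :: 'a sweedler)"
  "sw_b * sw_c = (- (sw_c * sw_b) :: 'a sweedler)"
  by (simp_all add: sw_defs)

lemma sweedler_expand:
  "Sw p q r s = sw_scale p 1 + sw_scale q sw_c + sw_scale r sw_b + sw_scale s (sw_c * sw_b)"
  by (simp add: sw_defs)

global_interpretation sweedler: vector_space "sw_scale :: 'f::field \<Rightarrow> _"
proof
  fix a b :: 'f and x y :: "'f sweedler"
  show "sw_scale a (x + y) = sw_scale a x + sw_scale a y"
    by (cases x; cases y) (simp add: sw_defs algebra_simps)
  show "sw_scale (a + b) x = sw_scale a x + sw_scale b x"
    "sw_scale a (sw_scale b x) = sw_scale (a * b) x" "sw_scale 1 x = x"
    by (cases x; simp add: sw_defs algebra_simps)+
qed

definition tensor :: "'f::field sweedler \<Rightarrow> 'f sweedler \<Rightarrow> 'f sweedler sweedler" where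
  "tensor x y = map_sweedler (\<lambda>t. sw_scale t x) y"

text \<open>The structure maps are given for \<open>'a \<otimes> H\<close>, on which they act as
  \<open>id \<otimes> \<Delta>\<close>, \<open>id \<otimes> \<epsilon>\<close> and \<open>id \<otimes> S\<close>.  On generators they are as in
  \<open>comul_generators\<close>, \<open>counit_generators\<close>, \<open>antipode_generators\<close> below.\<close>

fun comul :: "'a::ring_1 sweedler \<Rightarrow> 'a sweedler sweedler" where
  "comul (Sw p q r s) = Sw (Sw p 0 r 0) (Sw 0 q 0 s) (Sw 0 r 0 0) (Sw s 0 0 0)"

fun counit :: "'a::ring_1 sweedler \<Rightarrow> 'a" where
  "counit (Sw p q r s) = p + q"

fun antipode :: "'a::ring_1 sweedler \<Rightarrow> 'a sweedler" where
  "antipode (Sw p q r s) = Sw p q s (- r)"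

lemma comul_generators:
  "comul (1 :: 'f::field sweedler) = tensor 1 1"
  "comul (sw_c :: 'f sweedler) = tensor sw_c sw_c"
  "comul (sw_b :: 'f sweedler) = tensor sw_c sw_b + tensor sw_b 1"
  by (simp_all add: sw_defs tensor_def)

lemma comul_hom:
  fixes x y :: "'f::field sweedler"
  shows "comul (x * y) = comul x * comul y" "comul (x + y) = comul x + comul y"
    "comul (sw_scale t x) = sw_scale (sw_scale t 1) (comul x)"
    "comul (1 :: 'f sweedler) = 1"
  by (cases x; cases y; simp add: sw_defs algebra_simps)+

lemma counit_generators:
  "counit (sw_c :: 'a::ring_1 sweedler) = 1" "counit (sw_b :: 'a sweedler) = 0"
  by (simp_all add: sw_defs)

lemma counit_hom:
  fixes x y :: "'f::field sweedler"
  shows "counit (x * y) = counit x * counit y" "counit (x + y) = counit x + counit y"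
    "counit (sw_scale t x) = t * counit x" "counit (1 :: 'f sweedler) = 1"
  by (cases x; cases y; simp add: sw_defs algebra_simps)+

lemma antipode_generators:
  "antipode (sw_c :: 'a::ring_1 sweedler) = sw_c"
  "antipode (sw_b :: 'a sweedler) = - (sw_c * sw_b)"
  by (simp_all add: sw_defs)

lemma coassoc: "map_sweedler comul (comul x) = comul (comul (x :: 'f::field sweedler))"
  by (cases x) (simp add: sw_defs)

lemma counit_laws:
  fixes x :: "'f::field sweedler"
  shows "counit (comul x) = x" "map_sweedler counit (comul x) = x"
  by (cases x; simp add: sw_defs)+

fun mult_map :: "'f::field sweedler sweedler \<Rightarrow> 'f sweedler" where
  "mult_map (Sw u v w z) = u + v * sw_c + w * sw_b + z * (sw_c * sw_b)"

lemma antipode_laws: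
  fixes x :: "'f::field sweedler"
  shows "mult_map (antipode (comul x)) = sw_scale (counit x) 1"
    "mult_map (map_sweedler antipode (comul x)) = sw_scale (counit x) 1"
  by (cases x; simp add: sw_defs)+


section \<open>The dual and its action\<close>

definition fun_scale :: "'f::field \<Rightarrow> ('x \<Rightarrow> 'f) \<Rightarrow> 'x \<Rightarrow> 'f" where
  "fun_scale t g = (\<lambda>x. t * g x)"

global_interpretation functional: vector_space "fun_scale :: 'f::field \<Rightarrow> ('x \<Rightarrow> 'f) \<Rightarrow> _"
  by standard (auto simp: fun_scale_def fun_eq_iff algebra_simps)

definition sw_dual :: "('f::field sweedler \<Rightarrow> 'f) set" where
  "sw_dual = {g. Vector_Spaces.linear sw_scale (*) g}"

definition dual_basis :: "('l \<Rightarrow> 'f::field sweedler \<Rightarrow> 'f) \<Rightarrow> bool" where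
  "dual_basis \<gamma> \<longleftrightarrow>
     inj \<gamma> \<and> functional.independent (range \<gamma>) \<and> functional.span (range \<gamma>) = sw_dual"

text \<open>\<open>contract g\<close> is the map \<open>x \<otimes> y \<mapsto> g(y) x\<close> on \<open>H \<otimes> H\<close>, for linear \<open>g\<close>.\<close>

fun contract :: "('f::field sweedler \<Rightarrow> 'f) \<Rightarrow> 'f sweedler sweedler \<Rightarrow> 'f sweedler" where
  "contract g (Sw u v w z) =
     sw_scale (g 1) u + sw_scale (g sw_c) v + sw_scale (g sw_b) w + sw_scale (g (sw_c * sw_b)) z"

lemma sw_dual_expand:
  assumes "g \<in> sw_dual"
  shows "g (Sw p q r s) = p * g 1 + q * g sw_c + r * g sw_b + s * g (sw_c * sw_b)"
proof -
  have "module_hom sw_scale (*) g"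
    using assms by (simp add: sw_dual_def module_hom_iff_linear)
  then show ?thesis
    unfolding sweedler_expand[of p q r s]
    by (simp only: module_hom.add module_hom.scale)
qed

lemma contract_tensor:
  assumes "g \<in> sw_dual"
  shows "contract g (tensor x y) = sw_scale (g y) x"
proof -
  obtain p q r s where y: "y = Sw p q r s" by (cases y)
  have "contract g (tensor x y) =
      sw_scale (p * g 1 + q * g sw_c + r * g sw_b + s * g (sw_c * sw_b)) x"
    by (simp add: y tensor_def sweedler.scale_left_distrib mult.commute)
  then show ?thesis
    by (simp only: y sw_dual_expand[OF assms])
qed

definition dual_act :: "('f::field sweedler \<Rightarrow> 'f) \<Rightarrow> 'f sweedler \<Rightarrow> 'f sweedler" where
  "dual_act g h = contract g (comul h)"


section \<open>The free algebra with generators indexed by a basis of the dual\<close>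

text \<open>Words form the free monoid, written additively because \<^type>\<open>poly_mapping\<close> takes the
  exponent monoid additively; the (noncommutative) ring \<open>'x word \<Rightarrow>\<^sub>0 'f\<close> is then the
  free associative algebra on \<open>'x\<close>.\<close>

datatype 'x word = Word (letters: "'x list")

instantiation word :: (type) monoid_add
begin
definition "0 = Word []"
definition "u + v = Word (letters u @ letters v)"
instance by standard (auto simp: zero_word_def plus_word_def)
end

type_synonym ('f, 'x) free_alg = "'x word \<Rightarrow>\<^sub>0 'f"

definition free_scale :: "'f::field \<Rightarrow> ('f, 'x) free_alg \<Rightarrow> ('f, 'x) free_alg" where
  "free_scale t = Poly_Mapping.map ((*) t)"

lemma lookup_free_scale [simp]:
  "Poly_Mapping.lookup (free_scale t f) w = t * Poly_Mapping.lookup f w"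
  by (simp add: free_scale_def Poly_Mapping.map.rep_eq when_def)

global_interpretation free_alg: vector_space_quotient "free_scale :: 'f::field \<Rightarrow> ('f, 'x) free_alg \<Rightarrow> _"
  by standard (auto intro!: poly_mapping_eqI simp: lookup_add algebra_simps)

text \<open>The generator \<open>x_i\<^sup>k\<close> with \<open>k = \<gamma> \<beta>\<close> is the letter \<open>(i, \<beta>)\<close>, where \<open>i \<ge> 1\<close>;
  \<open>FXK\<close> is the subalgebra on the letters with admissible \<open>i\<close>.\<close>

definition FXK :: "('f::field, nat \<times> 'l) free_alg set" where
  "FXK = {f. \<forall>w\<in>Poly_Mapping.keys f. \<forall>(i, \<beta>)\<in>set (letters w). i \<ge> 1}"

definition gen :: "nat \<Rightarrow> 'l \<Rightarrow> ('f::field, nat \<times> 'l) free_alg" where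
  "gen i \<beta> = Poly_Mapping.single (Word [(i, \<beta>)]) 1"

definition var :: "('l \<Rightarrow> 'f::field sweedler \<Rightarrow> 'f) \<Rightarrow> nat \<Rightarrow> ('f sweedler \<Rightarrow> 'f)
    \<Rightarrow> ('f, nat \<times> 'l) free_alg" where
  "var \<gamma> i k =
     (let \<alpha> = (\<lambda>\<beta>. functional.representation (range \<gamma>) k (\<gamma> \<beta>))
      in \<Sum>\<beta> | \<alpha> \<beta> \<noteq> 0. free_scale (\<alpha> \<beta>) (gen i \<beta>))"

definition evaluate :: "('l \<Rightarrow> 'f::field sweedler \<Rightarrow> 'f) \<Rightarrow> (nat \<Rightarrow> 'f sweedler)
    \<Rightarrow> ('f, nat \<times> 'l) free_alg \<Rightarrow> 'f sweedler" where
  "evaluate \<gamma> a f =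
     (\<Sum>w\<in>Poly_Mapping.keys f. sw_scale (Poly_Mapping.lookup f w)
        (prod_list (map (\<lambda>(i, \<beta>). dual_act (\<gamma> \<beta>) (a i)) (letters w))))"

definition Id_dual :: "('l \<Rightarrow> 'f::field sweedler \<Rightarrow> 'f) \<Rightarrow> ('f, nat \<times> 'l) free_alg set" where
  "Id_dual \<gamma> = {f \<in> FXK. \<forall>a. evaluate \<gamma> a f = 0}"

definition P_dual :: "('l \<Rightarrow> 'f::field sweedler \<Rightarrow> 'f) \<Rightarrow> nat \<Rightarrow> ('f, nat \<times> 'l) free_alg set" where
  "P_dual \<gamma> n = free_alg.span
     {prod_list (map (\<lambda>j. var \<gamma> (\<sigma> j) (k j)) [1..<n+1]) | k \<sigma>.
        (\<forall>j\<in>{1..n}. k j \<in> sw_dual) \<and> \<sigma> permutes {1..n}}"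

definition codim_dual :: "('l \<Rightarrow> 'f::field sweedler \<Rightarrow> 'f) \<Rightarrow> nat \<Rightarrow> nat" where
  "codim_dual \<gamma> n = free_alg.quotient_dim (P_dual \<gamma> n) (P_dual \<gamma> n \<inter> Id_dual \<gamma>)"

end

theory Submission
  imports Defs
begin

text \<open>
  The lower bound is visible after composing with the counit, which kills \<open>b\<close> and \<open>cb\<close> and so
  hides how the order of the factors matters.  The counit is a homomorphism of algebras, and
  \<open>\<epsilon>(gh) = g(h\<^sub>(\<^sub>2\<^sub>)) \<epsilon>(h\<^sub>(\<^sub>1\<^sub>)) = g(h)\<close> for \<open>g \<in> H\<^sup>*\<close>.  Therefore it maps the value of the monomial
  \<open>x\<^sub>1\<^sup>g\<^sup>1 \<dots> x\<^sub>n\<^sup>g\<^sup>n\<close> at \<open>a\<^sub>1, \<dots>, a\<^sub>n\<close> to \<open>g\<^sub>1(a\<^sub>1) \<dots> g\<^sub>n(a\<^sub>n)\<close> (\<open>counit_evaluate_monomial\<close>).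
  When the \<open>g\<^sub>i\<close> run through the basis of \<open>H\<^sup>*\<close> dual to \<open>1, c, b, cb\<close>, these \<open>4\<^sup>n\<close> functions are
  dual to the \<open>4\<^sup>n\<close> tuples of basis elements of \<open>H\<close>, so the monomials are linearly independent
  modulo identities.  Thus \<open>4\<^sup>n \<le> c\<^sub>n\<close>, that is, \<open>C = 1\<close> and \<open>r = 0\<close> will do.

  For the upper bound, an element of \<open>P\<^sub>n\<close> defines an \<open>n\<close>-linear map \<open>H\<^sup>n \<rightarrow> H\<close>, which is zero only
  if the element is an identity.  Such a map is determined by its values at the \<open>4\<^sup>n\<close> tuples of
  basis elements (\<open>multilinear_eq_0\<close>), that is, by \<open>4\<^sup>n \<cdot> 4\<close> coordinates.
\<close>

section \<open>Bounds on the dimension of a quotient space\<close>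

context vector_space_quotient
begin

text \<open>The span of \<open>B\<close> is a complement of \<open>U\<close> in \<open>V\<close>, so \<open>\<Phi>\<close>, whose kernel in \<open>V\<close> lies in \<open>U\<close>, embeds
  it into the space of functions supported on \<open>Y\<close>.\<close>

lemma quotient_basis_card_le:
  fixes \<Phi> :: "'b \<Rightarrow> 'y \<Rightarrow> 'a"
  assumes V: "subspace V" and U: "subspace U" and B: "quotient_basis V U B"
    and lin: "Vector_Spaces.linear scale fun_scale \<Phi>"
    and fin: "finite Y" and supp: "\<And>v y. y \<notin> Y \<Longrightarrow> \<Phi> v y = 0"
    and ker: "\<And>v. v \<in> V \<Longrightarrow> \<Phi> v = 0 \<Longrightarrow> v \<in> U"
  shows "finite B \<and> card B \<le> card Y"
proof -
  interpret L: Vector_Spaces.linear scale fun_scale \<Phi> by (rule lin)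
  have BV: "B \<subseteq> V" and indep: "\<And>t r v. t \<subseteq> B \<Longrightarrow> finite t \<Longrightarrow>
      (\<Sum>v\<in>t. scale (r v) v) \<in> U \<Longrightarrow> v \<in> t \<Longrightarrow> r v = 0"
    using B unfolding quotient_basis_def by blast+
  have "0 \<in> U" using U by (rule subspace_0)
  then have indB: "independent B"
    unfolding independent_explicit_module using indep by simp
  have inj: "inj_on \<Phi> (span B)"
    unfolding L.inj_on_iff_eq_0[OF subspace_span]
  proof (intro ballI impI)
    fix x assume x: "x \<in> span B" "\<Phi> x = 0"
    have "x \<in> V" using x(1) span_minimal[OF BV V] by blast
    then have xU: "x \<in> U" using ker x(2) by blast
    obtain t r where t: "finite t" "t \<subseteq> B" "x = (\<Sum>v\<in>t. scale (r v) v)"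
      using x(1) unfolding span_explicit by blast
    then have "\<And>v. v \<in> t \<Longrightarrow> r v = 0" using indep xU by blast
    then show "x = 0" using t(3) by simp
  qed
  define \<delta> :: "'y \<Rightarrow> 'y \<Rightarrow> 'a" where "\<delta> y = (\<lambda>z. if z = y then 1 else 0)" for y
  have "\<Phi> ` B \<subseteq> functional.span (\<delta> ` Y)"
  proof
    fix g assume "g \<in> \<Phi> ` B"
    then have g: "g y = 0" if "y \<notin> Y" for y using supp that by blast
    have "g = (\<Sum>y\<in>Y. fun_scale (g y) (\<delta> y))"
    proof
      fix z
      have "(\<Sum>y\<in>Y. fun_scale (g y) (\<delta> y)) z = (\<Sum>y\<in>Y. if z = y then g y else 0)"
        by (induction Y rule: infinite_finite_induct) (auto simp: fun_scale_def \<delta>_def)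
      then show "g z = (\<Sum>y\<in>Y. fun_scale (g y) (\<delta> y)) z"
        using fin g by simp
    qed
    moreover have "(\<Sum>y\<in>Y. fun_scale (g y) (\<delta> y)) \<in> functional.span (\<delta> ` Y)"
      by (intro functional.span_sum functional.span_scale functional.span_base) auto
    ultimately show "g \<in> functional.span (\<delta> ` Y)" by simp
  qed
  with L.independent_injective_image[OF indB inj]
  have le: "finite (\<Phi> ` B) \<and> card (\<Phi> ` B) \<le> card (\<delta> ` Y)"
    using functional.independent_span_bound[of "\<delta> ` Y" "\<Phi> ` B"] fin by blast
  have injB: "inj_on \<Phi> B" using inj span_superset by (rule inj_on_subset)
  show ?thesis
    using le card_image_le[OF fin, of \<delta>] finite_imageD[OF _ injB]
    by (simp add: card_image[OF injB])
qed

text \<open>The functionals \<open>f \<mapsto> \<Psi> f t\<close> descend to \<open>V / U\<close> and are dual to the cosets of the \<open>f\<^sub>t\<close>, so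
  these cosets are linearly independent.\<close>

lemma card_le_quotient_basis:
  fixes \<Psi> :: "'b \<Rightarrow> 't \<Rightarrow> 'a"
  assumes B: "quotient_basis V U B" and finB: "finite B"
    and lin: "Vector_Spaces.linear scale fun_scale \<Psi>"
    and ker: "\<And>v. v \<in> U \<Longrightarrow> \<Psi> v = 0"
    and fV: "\<And>t. t \<in> T \<Longrightarrow> f t \<in> V"
    and dual: "\<And>s t. s \<in> T \<Longrightarrow> t \<in> T \<Longrightarrow> \<Psi> (f s) t = (if s = t then 1 else 0)"
  shows "card T \<le> card B"
proof -
  interpret L: Vector_Spaces.linear scale fun_scale \<Psi> by (rule lin)
  have "\<forall>v\<in>V. \<exists>w\<in>span B. v - w \<in> U"
    using B unfolding quotient_basis_def by (elim conjE)
  then have "\<forall>t\<in>T. \<exists>w. w \<in> span B \<and> f t - w \<in> U"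
    using fV by fast
  from bchoice[OF this] obtain w where "\<forall>t\<in>T. w t \<in> span B \<and> f t - w t \<in> U" ..
  then have w: "\<And>t. t \<in> T \<Longrightarrow> w t \<in> span B" "\<And>t. t \<in> T \<Longrightarrow> f t - w t \<in> U"
    by blast+
  have \<Psi>w: "\<Psi> (w s) t = (if s = t then 1 else 0)" if "s \<in> T" "t \<in> T" for s t
    using ker[OF w(2)[OF that(1)]] dual[OF that] by (simp add: L.diff)
  have inj: "inj_on w T"
  proof (rule inj_onI, rule ccontr)
    fix s t assume "s \<in> T" "t \<in> T" "w s = w t" "s \<noteq> t"
    then show False using \<Psi>w[of s t] \<Psi>w[of t t] by simp
  qed
  have "independent (w ` T)"
    unfolding independent_explicit_module
  proof (intro allI impI)
    fix X u v assume X: "finite X" "X \<subseteq> w ` T" "(\<Sum>x\<in>X. scale (u x) x) = 0" "v \<in> X"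
    obtain t where t: "t \<in> T" "v = w t" using X by blast
    have "0 = \<Psi> (\<Sum>x\<in>X. scale (u x) x) t" by (simp add: X(3) L.zero)
    also have "\<dots> = (\<Sum>x\<in>X. u x * \<Psi> x t)"
      unfolding L.sum L.scale
      by (induction X rule: infinite_finite_induct) (auto simp: fun_scale_def)
    also have "\<dots> = (\<Sum>x\<in>X. if x = v then u x else 0)"
    proof (rule sum.cong[OF refl])
      fix x assume "x \<in> X"
      then obtain s where s: "s \<in> T" "x = w s" using X(2) by blast
      then have "x = v \<longleftrightarrow> s = t" using t inj_onD[OF inj] by blast
      then show "u x * \<Psi> x t = (if x = v then u x else 0)"
        using \<Psi>w[OF s(1) t(1)] s(2) by simp
    qed
    also have "\<dots> = u v" using X by simp
    finally show "u v = 0" by simp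
  qed
  then have "card (w ` T) \<le> card B"
    using independent_span_bound[OF finB] w(1) by blast
  then show ?thesis using inj by (simp add: card_image)
qed

end

section \<open>Multilinear maps\<close>

text \<open>The arguments are replaced by basis elements one at a time.\<close>

lemma (in vector_space_pair) multilinear_eq_0:
  fixes \<Phi> :: "('i \<Rightarrow> 'b) \<Rightarrow> 'c"
  assumes S: "vs1.span S = UNIV" and I: "finite I"
    and lin: "\<And>a i. i \<in> I \<Longrightarrow> Vector_Spaces.linear s1 s2 (\<lambda>h. \<Phi> (a(i := h)))"
    and zero: "\<And>a. (\<forall>i\<in>I. a i \<in> S) \<Longrightarrow> \<Phi> a = 0"
  shows "\<Phi> a = 0"
proof -
  have "(\<forall>i\<in>I - J. a i \<in> S) \<Longrightarrow> \<Phi> a = 0" if "J \<subseteq> I" for J a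
    using finite_subset[OF that I] that
  proof (induction J arbitrary: a)
    case empty
    then show ?case using zero by simp
  next
    case (insert j J)
    have "\<Phi> (a(j := h)) = 0" if "h \<in> S" for h
      using insert that by (intro insert.IH) auto
    then have "\<Phi> (a(j := a j)) = 0"
      using linear_eq_0_on_span[OF lin[of j a], of S "a j"] S insert.prems by simp
    then show ?case by simp
  qed
  from this[of I] show ?thesis by simp
qed

section \<open>Sweedler's algebra\<close>

lemma sw_scale_Sw [simp]: "sw_scale t (Sw p q r s) = Sw (t * p) (t * q) (t * r) (t * s)"
  by (simp add: sw_scale_def)

lemma sw_scale_mult:
  fixes x y :: "'f::field sweedler"
  shows "sw_scale s x * sw_scale t y = sw_scale (s * t) (x * y)"
  by (cases x; cases y) (simp add: algebra_simps)

lemma sw_scale_mult_left: "sw_scale s (x :: 'f::field sweedler) * y = sw_scale s (x * y)"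
  using sw_scale_mult[of s x 1 y] by simp

lemma sw_scale_mult_right: "(x :: 'f::field sweedler) * sw_scale s y = sw_scale s (x * y)"
  using sw_scale_mult[of 1 x s y] by simp

definition sw_basis :: "'f::field sweedler set" where
  "sw_basis = {1, sw_c, sw_b, sw_c * sw_b}"

lemma card_sw_basis: "card (sw_basis :: 'f::field sweedler set) = 4"
  by (simp add: sw_basis_def sw_defs)

lemma finite_sw_basis: "finite (sw_basis :: 'f::field sweedler set)"
  by (simp add: sw_basis_def)

lemma span_sw_basis: "sweedler.span (sw_basis :: 'f::field sweedler set) = UNIV"
proof -
  have "Sw p q r s \<in> sweedler.span sw_basis" for p q r s :: 'f
    unfolding sweedler_expand[of p q r s] sw_basis_def
    by (intro sweedler.span_add sweedler.span_scale sweedler.span_base) auto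
  then show ?thesis by (metis UNIV_eq_I sweedler.exhaust)
qed

lemma independent_sw_basis: "sweedler.independent (sw_basis :: 'f::field sweedler set)"
proof (rule sweedler.independent_if_scalars_zero)
  fix f :: "'f sweedler \<Rightarrow> 'f" and x :: "'f sweedler"
  assume "(\<Sum>x\<in>sw_basis. sw_scale (f x) x) = 0" "x \<in> sw_basis"
  then show "f x = 0" by (auto simp: sw_basis_def sw_defs)
qed (simp add: finite_sw_basis)

definition sw_coord :: "'f::field sweedler \<Rightarrow> 'f sweedler \<Rightarrow> 'f" where
  "sw_coord y h = sweedler.representation sw_basis h y"

lemma sw_coord_add: "sw_coord y (g + h) = sw_coord y g + sw_coord y h"
  by (simp add: sw_coord_def sweedler.representation_add[OF independent_sw_basis] span_sw_basis)

lemma sw_coord_scale: "sw_coord y (sw_scale t h) = t * sw_coord y h"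
  by (simp add: sw_coord_def sweedler.representation_scale[OF independent_sw_basis] span_sw_basis)

lemma sw_coord_basis: "x \<in> sw_basis \<Longrightarrow> sw_coord y x = (if x = y then 1 else 0)"
  by (simp add: sw_coord_def sweedler.representation_basis[OF independent_sw_basis])

lemma sw_coord_outside: "y \<notin> sw_basis \<Longrightarrow> sw_coord y h = 0"
  unfolding sw_coord_def using sweedler.representation_ne_zero by blast

lemma sw_coord_eq_0: "(\<And>y. sw_coord y h = 0) \<Longrightarrow> h = 0"
  using sweedler.sum_nonzero_representation_eq[OF independent_sw_basis, of h]
  by (simp add: sw_coord_def span_sw_basis)

lemma vector_space_field: "vector_space ((*) :: 'f::field \<Rightarrow> 'f \<Rightarrow> 'f)"
  by standard (auto simp: algebra_simps)

lemma sw_coord_in_dual: "sw_coord y \<in> sw_dual"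
  by (simp add: sw_dual_def Vector_Spaces.linear_iff sw_coord_add sw_coord_scale vector_space_field
      sweedler.vector_space_axioms)

lemma linear_dual_act:
  "Vector_Spaces.linear sw_scale sw_scale (dual_act (g :: 'f::field sweedler \<Rightarrow> 'f))"
proof -
  have "dual_act g (x + y) = dual_act g x + dual_act g y" for x y
    by (cases x; cases y) (simp add: dual_act_def algebra_simps)
  moreover have "dual_act g (sw_scale t x) = sw_scale t (dual_act g x)" for t x
    by (cases x) (simp add: dual_act_def algebra_simps)
  ultimately show ?thesis
    by (simp add: Vector_Spaces.linear_iff sweedler.vector_space_axioms)
qed

lemma dual_act_sum_scale:
  "dual_act (\<Sum>i\<in>I. fun_scale (t i) (g i)) h = (\<Sum>i\<in>I. sw_scale (t i) (dual_act (g i) h))"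
proof -
  have add: "dual_act (f + g) h = dual_act f h + dual_act g h" for f g :: "'a sweedler \<Rightarrow> 'a"
    by (cases h) (simp add: dual_act_def algebra_simps)
  have scale: "dual_act (fun_scale t g) h = sw_scale t (dual_act g h)" for t g
    by (cases h) (simp add: dual_act_def fun_scale_def algebra_simps)
  have zero: "dual_act 0 h = 0"
    using scale[of 0 0] by (simp add: sweedler.scale_zero_left functional.scale_zero_left)
  show ?thesis
    by (induction I rule: infinite_finite_induct)
      (simp_all only: sum.infinite sum.empty sum.insert not_False_eq_True add scale zero)
qed

text \<open>Here \<open>(\<epsilon> \<otimes> id) \<Delta> = id\<close> is used: the counit removes the first tensor factor
  of \<open>\<Delta> h\<close>, the one on which \<open>g\<close> does not act.\<close>

lemma counit_dual_act:
  assumes "g \<in> sw_dual"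
  shows "counit (dual_act g h) = g h"
proof (cases h)
  case (Sw p q r s)
  have "counit (dual_act g h) = p * g 1 + q * g sw_c + r * g sw_b + s * g (sw_c * sw_b)"
    by (simp add: Sw dual_act_def)
  then show ?thesis by (simp only: Sw sw_dual_expand[OF assms])
qed

lemma counit_prod_list:
  "counit (prod_list xs) = prod_list (map counit (xs :: 'f::field sweedler list))"
  by (induction xs) (simp_all add: counit_hom)

section \<open>Evaluation in the free algebra\<close>

lemma evaluate_superset:
  assumes "finite W" "Poly_Mapping.keys f \<subseteq> W"
  shows "evaluate \<gamma> a f = (\<Sum>w\<in>W. sw_scale (Poly_Mapping.lookup f w)
    (prod_list (map (\<lambda>(i, \<beta>). dual_act (\<gamma> \<beta>) (a i)) (letters w))))"
  unfolding evaluate_def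
  by (rule sum.mono_neutral_left[OF assms])
    (simp add: in_keys_iff sweedler.scale_zero_left)

lemma evaluate_zero: "evaluate \<gamma> a 0 = 0"
  by (simp add: evaluate_def)

lemma evaluate_add: "evaluate \<gamma> a (f + g) = evaluate \<gamma> a f + evaluate \<gamma> a g"
proof -
  let ?W = "Poly_Mapping.keys f \<union> Poly_Mapping.keys g"
  have "finite ?W" "Poly_Mapping.keys (f + g) \<subseteq> ?W" using keys_add[of f g] by auto
  then show ?thesis
    using evaluate_superset[of ?W "f + g" \<gamma> a] evaluate_superset[of ?W f \<gamma> a]
      evaluate_superset[of ?W g \<gamma> a]
    by (simp add: lookup_add sweedler.scale_left_distrib sum.distrib)
qed

lemma evaluate_scale: "evaluate \<gamma> a (free_scale t f) = sw_scale t (evaluate \<gamma> a f)"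
proof -
  have "Poly_Mapping.keys (free_scale t f) \<subseteq> Poly_Mapping.keys f"
    by (auto simp: in_keys_iff)
  then show ?thesis
    using evaluate_superset[of "Poly_Mapping.keys f" "free_scale t f" \<gamma> a]
    by (simp add: evaluate_def sweedler.scale_sum_right)
qed

lemma evaluate_sum: "evaluate \<gamma> a (sum f I) = (\<Sum>i\<in>I. evaluate \<gamma> a (f i))"
  by (induction I rule: infinite_finite_induct) (simp_all add: evaluate_zero evaluate_add)

lemma evaluate_single:
  "evaluate \<gamma> a (Poly_Mapping.single w t) =
    sw_scale t (prod_list (map (\<lambda>(i, \<beta>). dual_act (\<gamma> \<beta>) (a i)) (letters w)))"
  by (simp add: evaluate_superset[of "{w}"])

lemma sum_single_keys:
  "f = (\<Sum>w\<in>Poly_Mapping.keys f. Poly_Mapping.single w (Poly_Mapping.lookup f w))"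
  by (rule poly_mapping_eqI) (simp add: lookup_sum lookup_single when_def in_keys_iff)

lemma evaluate_mult: "evaluate \<gamma> a (f * g) = evaluate \<gamma> a f * evaluate \<gamma> a g"
proof -
  have single: "evaluate \<gamma> a (Poly_Mapping.single u s * Poly_Mapping.single v t) =
      evaluate \<gamma> a (Poly_Mapping.single u s) * evaluate \<gamma> a (Poly_Mapping.single v t)" for u v s t
    by (simp add: mult_single evaluate_single plus_word_def sw_scale_mult)
  have "f * g = (\<Sum>u\<in>Poly_Mapping.keys f. \<Sum>v\<in>Poly_Mapping.keys g.
      Poly_Mapping.single u (Poly_Mapping.lookup f u) *
      Poly_Mapping.single v (Poly_Mapping.lookup g v))"
    by (simp only: sum_product[symmetric] sum_single_keys[symmetric])
  then have "evaluate \<gamma> a (f * g) =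
      (\<Sum>u\<in>Poly_Mapping.keys f. \<Sum>v\<in>Poly_Mapping.keys g.
        evaluate \<gamma> a (Poly_Mapping.single u (Poly_Mapping.lookup f u)) *
        evaluate \<gamma> a (Poly_Mapping.single v (Poly_Mapping.lookup g v)))"
    by (simp only: evaluate_sum single)
  then show ?thesis
    by (simp only: sum_product[symmetric] evaluate_sum[symmetric] sum_single_keys[symmetric])
qed

lemma evaluate_one: "evaluate \<gamma> a 1 = 1"
  unfolding single_one[symmetric] evaluate_single by (simp add: zero_word_def)

lemma evaluate_prod_list: "evaluate \<gamma> a (prod_list fs) = prod_list (map (evaluate \<gamma> a) fs)"
  by (induction fs) (simp_all add: evaluate_one evaluate_mult)

lemma evaluate_var:
  assumes \<gamma>: "dual_basis \<gamma>" and k: "k \<in> sw_dual"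
  shows "evaluate \<gamma> a (var \<gamma> i k) = dual_act k (a i)"
proof -
  let ?r = "functional.representation (range \<gamma>) k"
  have inj: "inj \<gamma>" and ind: "functional.independent (range \<gamma>)"
    and span: "k \<in> functional.span (range \<gamma>)"
    using \<gamma> k by (auto simp: dual_basis_def)
  have "?r v \<noteq> 0 \<Longrightarrow> v \<in> range \<gamma>" for v
    by (rule functional.representation_ne_zero)
  then have im: "{v. ?r v \<noteq> 0} = \<gamma> ` {\<beta>. ?r (\<gamma> \<beta>) \<noteq> 0}" by blast
  have "k = (\<Sum>v | ?r v \<noteq> 0. fun_scale (?r v) v)"
    using functional.sum_nonzero_representation_eq[OF ind span] by simp
  also have "\<dots> = (\<Sum>\<beta> | ?r (\<gamma> \<beta>) \<noteq> 0. fun_scale (?r (\<gamma> \<beta>)) (\<gamma> \<beta>))"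
    unfolding im by (subst sum.reindex) (auto intro: inj_on_subset[OF inj])
  finally have k_eq: "k = (\<Sum>\<beta> | ?r (\<gamma> \<beta>) \<noteq> 0. fun_scale (?r (\<gamma> \<beta>)) (\<gamma> \<beta>))" .
  have "dual_act k (a i) =
      (\<Sum>\<beta> | ?r (\<gamma> \<beta>) \<noteq> 0. sw_scale (?r (\<gamma> \<beta>)) (dual_act (\<gamma> \<beta>) (a i)))"
    unfolding dual_act_sum_scale[symmetric] by (rule arg_cong[OF k_eq])
  also have "\<dots> = evaluate \<gamma> a (var \<gamma> i k)"
    by (simp add: var_def evaluate_sum evaluate_scale gen_def evaluate_single)
  finally show ?thesis ..
qed

lemma evaluate_monomial:
  assumes "dual_basis \<gamma>" "\<forall>j\<in>{1..n}. k j \<in> sw_dual"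
  shows "evaluate \<gamma> a (prod_list (map (\<lambda>j. var \<gamma> (\<sigma> j) (k j)) [1..<n+1])) =
    prod_list (map (\<lambda>j. dual_act (k j) (a (\<sigma> j))) [1..<n+1])"
proof -
  have "map (\<lambda>j. evaluate \<gamma> a (var \<gamma> (\<sigma> j) (k j))) [1..<n+1] =
      map (\<lambda>j. dual_act (k j) (a (\<sigma> j))) [1..<n+1]"
    by (rule map_cong[OF refl]) (use assms in \<open>auto simp: evaluate_var\<close>)
  then show ?thesis by (simp only: evaluate_prod_list map_map o_def)
qed

lemma counit_evaluate_monomial:
  assumes "dual_basis \<gamma>" "\<forall>j\<in>{1..n}. k j \<in> sw_dual"
  shows "counit (evaluate \<gamma> a (prod_list (map (\<lambda>j. var \<gamma> (\<sigma> j) (k j)) [1..<n+1]))) =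
    (\<Prod>j\<in>{1..n}. k j (a (\<sigma> j)))"
proof -
  have "map (\<lambda>j. counit (dual_act (k j) (a (\<sigma> j)))) [1..<n+1] =
      map (\<lambda>j. k j (a (\<sigma> j))) [1..<n+1]"
    by (rule map_cong[OF refl]) (use assms(2) in \<open>auto simp: counit_dual_act\<close>)
  then have "counit (evaluate \<gamma> a (prod_list (map (\<lambda>j. var \<gamma> (\<sigma> j) (k j)) [1..<n+1]))) =
      prod_list (map (\<lambda>j. k j (a (\<sigma> j))) [1..<n+1])"
    by (simp only: evaluate_monomial[OF assms] counit_prod_list map_map o_def)
  also have "\<dots> = (\<Prod>j\<in>{1..n}. k j (a (\<sigma> j)))"
    using prod.distinct_set_conv_list[of "[1..<n+1]" "\<lambda>j. k j (a (\<sigma> j))"]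
    by (simp add: atLeastLessThanSuc_atLeastAtMost del: upt_Suc)
  finally show ?thesis .
qed

section \<open>Multilinear polynomials and identities\<close>

lemma subspace_FXK: "free_alg.subspace FXK"
  unfolding free_alg.subspace_def FXK_def
  using keys_add by (fastforce simp: in_keys_iff lookup_add)

lemma FXK_mult: "f \<in> FXK \<Longrightarrow> g \<in> FXK \<Longrightarrow> f * g \<in> FXK"
  unfolding FXK_def using keys_mult[of f g] by (fastforce simp: plus_word_def)

lemma FXK_one: "1 \<in> FXK"
  by (simp add: FXK_def zero_word_def)

lemma FXK_prod_list: "(\<And>f. f \<in> set fs \<Longrightarrow> f \<in> FXK) \<Longrightarrow> prod_list fs \<in> FXK"
  by (induction fs) (simp_all add: FXK_one FXK_mult)

lemma FXK_var:
  assumes "i \<ge> 1"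
  shows "var \<gamma> i k \<in> FXK"
proof -
  have "gen i \<beta> \<in> FXK" for \<beta> :: 'a
    using assms by (simp add: gen_def FXK_def)
  then show ?thesis
    unfolding var_def Let_def
    by (intro free_alg.subspace_sum[OF subspace_FXK] free_alg.subspace_scale[OF subspace_FXK])
qed

lemma P_dual_subset_FXK: "P_dual \<gamma> n \<subseteq> FXK"
  unfolding P_dual_def
proof (rule free_alg.span_minimal[OF _ subspace_FXK], clarify)
  fix k \<sigma> assume "\<sigma> permutes {1..n}"
  then have "\<sigma> j \<ge> 1" if "j \<in> {1..n}" for j
    using permutes_in_image[of \<sigma> "{1..n}" j] that by simp
  then show "prod_list (map (\<lambda>j. var \<gamma> (\<sigma> j) (k j)) [1..<n+1]) \<in> FXK"
    by (intro FXK_prod_list) (auto simp del: upt_Suc intro!: FXK_var)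
qed

lemma subspace_Id_dual: "free_alg.subspace (Id_dual \<gamma>)"
proof -
  show ?thesis
    using subspace_FXK
    by (auto simp: free_alg.subspace_def Id_dual_def evaluate_add evaluate_scale evaluate_zero
        sweedler.scale_zero_right)
qed

text \<open>The maps \<open>H\<^sup>n \<rightarrow> H\<close> defined by elements of \<open>P\<^sub>n\<close> are the linear combinations of those defined
  by monomials; a property \<open>Q\<close> of such maps need only be checked on the latter.\<close>

lemma P_dual_induct [consumes 2, case_names monomial zero add scale]:
  assumes "dual_basis \<gamma>" "f \<in> P_dual \<gamma> n"
    and "\<And>k \<sigma>. \<forall>j\<in>{1..n}. k j \<in> sw_dual \<Longrightarrow> \<sigma> permutes {1..n} \<Longrightarrow>
      Q (\<lambda>a. prod_list (map (\<lambda>j. dual_act (k j) (a (\<sigma> j))) [1..<n+1]))"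
    and "Q (\<lambda>a. 0)"
    and "\<And>\<phi> \<psi>. Q \<phi> \<Longrightarrow> Q \<psi> \<Longrightarrow> Q (\<lambda>a. \<phi> a + \<psi> a)"
    and "\<And>t \<phi>. Q \<phi> \<Longrightarrow> Q (\<lambda>a. sw_scale t (\<phi> a))"
  shows "Q (\<lambda>a. evaluate \<gamma> a f)"
  using assms(2) unfolding P_dual_def
proof (induction rule: free_alg.span_induct_alt)
  case base
  then show ?case using assms(4) by (simp add: evaluate_zero)
next
  case (step t f g)
  then obtain k \<sigma> where f: "f = prod_list (map (\<lambda>j. var \<gamma> (\<sigma> j) (k j)) [1..<n+1])"
    and k: "\<forall>j\<in>{1..n}. k j \<in> sw_dual" and \<sigma>: "\<sigma> permutes {1..n}" by blast
  have "Q (\<lambda>a. evaluate \<gamma> a f)"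
    unfolding f evaluate_monomial[OF assms(1) k] by (rule assms(3)[OF k \<sigma>])
  then show ?case
    unfolding evaluate_add evaluate_scale using assms(5,6) step by blast
qed

text \<open>Exactly one factor of a monomial contains the \<open>i\<close>-th argument.\<close>

lemma linear_evaluate_argument:
  assumes "dual_basis \<gamma>" "f \<in> P_dual \<gamma> n" "i \<in> {1..n}"
  shows "Vector_Spaces.linear sw_scale sw_scale (\<lambda>h. evaluate \<gamma> (a(i := h)) f)"
  using assms(1,2)
proof (induction rule: P_dual_induct)
  case (monomial k \<sigma>)
  obtain m where m: "m \<in> {1..n}" "\<sigma> m = i"
    using monomial(2) assms(3) by (metis imageE permutes_image)
  then have "m \<in> set [1..<n+1]" by auto
  then obtain ys zs where split: "[1..<n+1] = ys @ m # zs" by (meson split_list)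
  have "distinct (ys @ m # zs)" unfolding split[symmetric] by simp
  then have other: "\<sigma> j \<noteq> i" if "j \<in> set ys \<union> set zs" for j
    using that m permutes_inj[OF monomial(2)] by (auto simp: inj_eq)
  define u where "u = prod_list (map (\<lambda>j. dual_act (k j) (a (\<sigma> j))) ys)"
  define v where "v = prod_list (map (\<lambda>j. dual_act (k j) (a (\<sigma> j))) zs)"
  have "prod_list (map (\<lambda>j. dual_act (k j) ((a(i := h)) (\<sigma> j))) [1..<n+1]) =
      u * dual_act (k m) h * v" for h
  proof -
    have "map (\<lambda>j. dual_act (k j) ((a(i := h)) (\<sigma> j))) ys =
        map (\<lambda>j. dual_act (k j) (a (\<sigma> j))) ys"
      "map (\<lambda>j. dual_act (k j) ((a(i := h)) (\<sigma> j))) zs =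
        map (\<lambda>j. dual_act (k j) (a (\<sigma> j))) zs"
      using other by auto
    then show ?thesis
      unfolding split u_def v_def map_append list.map prod_list.append prod_list.Cons
      by (simp only: mult.assoc m(2) fun_upd_same)
  qed
  moreover have "Vector_Spaces.linear sw_scale sw_scale (\<lambda>h. u * dual_act (k m) h * v)"
    using linear_dual_act[of "k m"]
    by (simp add: Vector_Spaces.linear_iff algebra_simps sw_scale_mult_left sw_scale_mult_right)
  ultimately show ?case by simp
qed (auto simp: Vector_Spaces.linear_iff sweedler.vector_space_axioms sweedler.scale_zero_right
      sweedler.scale_right_distrib algebra_simps)

lemma evaluate_cong:
  assumes "dual_basis \<gamma>" "f \<in> P_dual \<gamma> n" "\<And>i. i \<in> {1..n} \<Longrightarrow> a i = a' i"
  shows "evaluate \<gamma> a f = evaluate \<gamma> a' f"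
  using assms(1,2)
proof (induction rule: P_dual_induct)
  case (monomial k \<sigma>)
  have "a (\<sigma> j) = a' (\<sigma> j)" if "j \<in> {1..n}" for j
    using assms(3) permutes_in_image[OF monomial(2)] that by blast
  then show ?case
    by (auto simp del: upt_Suc intro!: arg_cong[of _ _ prod_list])
qed auto

text \<open>The argument tuples are fixed to be \<^const>\<open>undefined\<close> outside \<open>{1..n}\<close> so that there are
  finitely many of them.\<close>

definition basis_tuples :: "nat \<Rightarrow> (nat \<Rightarrow> 'f::field sweedler) set" where
  "basis_tuples n = {1..n} \<rightarrow>\<^sub>E sw_basis"

lemma finite_basis_tuples: "finite (basis_tuples n :: (nat \<Rightarrow> 'f::field sweedler) set)"
  by (simp add: basis_tuples_def finite_PiE finite_sw_basis)

lemma card_basis_tuples: "card (basis_tuples n :: (nat \<Rightarrow> 'f::field sweedler) set) = 4 ^ n"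
  by (simp add: basis_tuples_def card_PiE card_sw_basis)

lemma Id_dual_if_zero_on_basis_tuples:
  fixes \<gamma> :: "'l \<Rightarrow> 'f::field sweedler \<Rightarrow> 'f"
  assumes "dual_basis \<gamma>" "f \<in> P_dual \<gamma> n"
    and zero: "\<And>a. a \<in> basis_tuples n \<Longrightarrow> evaluate \<gamma> a f = 0"
  shows "f \<in> Id_dual \<gamma>"
proof -
  interpret vector_space_pair "sw_scale :: 'f \<Rightarrow> _" "sw_scale :: 'f \<Rightarrow> _" by standard
  have "evaluate \<gamma> a f = 0" for a
  proof (rule multilinear_eq_0[where \<Phi> = "\<lambda>a. evaluate \<gamma> a f", OF span_sw_basis finite_atLeastAtMost])
    fix a :: "nat \<Rightarrow> 'f sweedler" assume "\<forall>i\<in>{1..n}. a i \<in> sw_basis"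
    then have "restrict a {1..n} \<in> basis_tuples n" by (auto simp: basis_tuples_def)
    from zero[OF this] show "evaluate \<gamma> a f = 0"
      using evaluate_cong[OF assms(1,2), of a "restrict a {1..n}"] by simp
  qed (rule linear_evaluate_argument[OF assms(1,2)])
  then show ?thesis
    using assms(2) P_dual_subset_FXK by (auto simp: Id_dual_def)
qed

section \<open>Codimensions\<close>

lemma codim_dual_basis:
  obtains B where "free_alg.quotient_basis (P_dual \<gamma> n) (P_dual \<gamma> n \<inter> Id_dual \<gamma>) B"
    "codim_dual \<gamma> n = card B"
proof
  have "free_alg.subspace (P_dual \<gamma> n)" unfolding P_dual_def by simp
  from free_alg.quotient_basis_exists[OF free_alg.subspace_inter[OF this subspace_Id_dual] this]
  show "free_alg.quotient_basis (P_dual \<gamma> n) (P_dual \<gamma> n \<inter> Id_dual \<gamma>)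
      (SOME B. free_alg.quotient_basis (P_dual \<gamma> n) (P_dual \<gamma> n \<inter> Id_dual \<gamma>) B)"
    by (rule someI_ex) simp
qed (simp add: codim_dual_def free_alg.quotient_dim_def)

text \<open>Finiteness is kept in the conclusion because the lower bound depends on it: an infinite basis
  would have \<^const>\<open>card\<close> 0.\<close>

lemma card_codim_basis_le:
  fixes \<gamma> :: "'l \<Rightarrow> 'f::field sweedler \<Rightarrow> 'f"
  assumes \<gamma>: "dual_basis \<gamma>"
    and B: "free_alg.quotient_basis (P_dual \<gamma> n) (P_dual \<gamma> n \<inter> Id_dual \<gamma>) B"
  shows "finite B \<and> card B \<le> 4 ^ (n + 1)"
proof -
  define \<Phi> where "\<Phi> f = (\<lambda>(a, y).
    if a \<in> basis_tuples n then sw_coord y (evaluate \<gamma> a f) else 0)" for f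
  have "finite B \<and> card B \<le> card ((basis_tuples n :: (nat \<Rightarrow> 'f sweedler) set) \<times> (sw_basis :: 'f sweedler set))"
  proof (rule free_alg.quotient_basis_card_le[OF _ _ B])
    show P: "free_alg.subspace (P_dual \<gamma> n)" unfolding P_dual_def by simp
    show "free_alg.subspace (P_dual \<gamma> n \<inter> Id_dual \<gamma>)"
      by (rule free_alg.subspace_inter[OF P subspace_Id_dual])
    show "Vector_Spaces.linear free_scale fun_scale \<Phi>"
      by (auto simp: Vector_Spaces.linear_iff \<Phi>_def fun_eq_iff fun_scale_def evaluate_add
          evaluate_scale sw_coord_add sw_coord_scale free_alg.vector_space_axioms
          functional.vector_space_axioms)
    show "finite ((basis_tuples n :: (nat \<Rightarrow> 'f sweedler) set) \<times> (sw_basis :: 'f sweedler set))"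
      by (simp add: finite_basis_tuples finite_sw_basis)
    show "\<Phi> f z = 0" if "z \<notin> basis_tuples n \<times> sw_basis" for f z
      using that sw_coord_outside by (force simp: \<Phi>_def split: prod.splits)
    show "f \<in> P_dual \<gamma> n \<inter> Id_dual \<gamma>" if f: "f \<in> P_dual \<gamma> n" "\<Phi> f = 0" for f
    proof -
      have "evaluate \<gamma> a f = 0" if a: "a \<in> basis_tuples n" for a
      proof (rule sw_coord_eq_0)
        show "sw_coord y (evaluate \<gamma> a f) = 0" for y
          using fun_cong[OF f(2), of "(a, y)"] a by (simp add: \<Phi>_def)
      qed
      then show ?thesis
        using Id_dual_if_zero_on_basis_tuples[OF \<gamma> f(1)] f(1) by blast
    qed
  qed
  then show ?thesis
    by (simp add: card_cartesian_product card_basis_tuples card_sw_basis mult.commute)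
qed

lemma codim_dual_upper:
  assumes "dual_basis \<gamma>"
  shows "codim_dual \<gamma> n \<le> 4 ^ (n + 1)"
proof -
  obtain B where "free_alg.quotient_basis (P_dual \<gamma> n) (P_dual \<gamma> n \<inter> Id_dual \<gamma>) B"
    "codim_dual \<gamma> n = card B" by (rule codim_dual_basis)
  then show ?thesis using card_codim_basis_le[OF assms] by simp
qed

lemma codim_dual_lower:
  fixes \<gamma> :: "'l \<Rightarrow> 'f::field sweedler \<Rightarrow> 'f"
  assumes \<gamma>: "dual_basis \<gamma>"
  shows "4 ^ n \<le> codim_dual \<gamma> n"
proof -
  obtain B where B: "free_alg.quotient_basis (P_dual \<gamma> n) (P_dual \<gamma> n \<inter> Id_dual \<gamma>) B"
    and card: "codim_dual \<gamma> n = card B" by (rule codim_dual_basis)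
  define f where "f s = prod_list (map (\<lambda>j. var \<gamma> (id j) (sw_coord (s j))) [1..<n+1])"
    for s :: "nat \<Rightarrow> 'f sweedler"
  \<comment> \<open>Identities vanish under \<open>\<Psi>\<close>, and the monomials \<open>f s\<close> become dual to the basis tuples.\<close>
  define \<Psi> where "\<Psi> g = (\<lambda>a. counit (evaluate \<gamma> a g))" for g
  have "card (basis_tuples n :: (nat \<Rightarrow> 'f sweedler) set) \<le> card B"
  proof (rule free_alg.card_le_quotient_basis[OF B])
    show "finite B" using card_codim_basis_le[OF \<gamma> B] by blast
    show "Vector_Spaces.linear free_scale fun_scale \<Psi>"
      by (auto simp: Vector_Spaces.linear_iff \<Psi>_def fun_eq_iff fun_scale_def evaluate_add
          evaluate_scale counit_hom free_alg.vector_space_axioms functional.vector_space_axioms)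
    show "\<Psi> g = 0" if "g \<in> P_dual \<gamma> n \<inter> Id_dual \<gamma>" for g
      using that by (auto simp: \<Psi>_def Id_dual_def fun_eq_iff zero_sweedler_def)
    show "f s \<in> P_dual \<gamma> n" for s
      unfolding P_dual_def
    proof (rule free_alg.span_base, rule CollectI, intro exI conjI ballI)
      show "f s = prod_list (map (\<lambda>j. var \<gamma> (id j) (sw_coord (s j))) [1..<n+1])"
        by (rule f_def)
      show "id permutes {1..n}" by (rule permutes_id)
    qed (rule sw_coord_in_dual)
    show "\<Psi> (f s) t = (if s = t then 1 else 0)" if s: "s \<in> basis_tuples n" and t: "t \<in> basis_tuples n" for s t
    proof -
      have "\<Psi> (f s) t = (\<Prod>j\<in>{1..n}. sw_coord (s j) (t (id j)))"
        unfolding \<Psi>_def f_def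
        by (rule counit_evaluate_monomial[OF \<gamma>]) (simp add: sw_coord_in_dual)
      also have "\<dots> = (\<Prod>j\<in>{1..n}. if t j = s j then 1 else 0)"
      proof (rule prod.cong[OF refl])
        fix j assume "j \<in> {1..n}"
        then have "t j \<in> sw_basis" using t unfolding basis_tuples_def by (rule PiE_mem[rotated])
        then show "sw_coord (s j) (t (id j)) = (if t j = s j then 1 else 0)"
          by (simp add: sw_coord_basis)
      qed
      also have "\<dots> = (if \<forall>j\<in>{1..n}. t j = s j then 1 else 0)"
        by (auto intro!: prod.neutral)
      also have "(\<forall>j\<in>{1..n}. t j = s j) \<longleftrightarrow> s = t"
        using PiE_ext[OF s[unfolded basis_tuples_def] t[unfolded basis_tuples_def]] by auto
      finally show ?thesis .
    qed
  qed
  then show ?thesis by (simp add: card card_basis_tuples)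
qed

theorem theorem8:
  fixes \<gamma> :: "'l \<Rightarrow> 'f::field_char_0 sweedler \<Rightarrow> 'f"
  assumes "dual_basis \<gamma>"
  shows "\<exists>C r :: real. C > 0 \<and>
    (\<forall>n\<ge>1. C * real n powr r * 4 ^ n \<le> real (codim_dual \<gamma> n) \<and> codim_dual \<gamma> n \<le> 4 ^ (n + 1))"
proof (intro exI conjI allI impI)
  show "(1::real) > 0" by simp
  show "codim_dual \<gamma> n \<le> 4 ^ (n + 1)" for n
    by (rule codim_dual_upper[OF assms])
  fix n :: nat assume "n \<ge> 1"
  have "real (4 ^ n) \<le> real (codim_dual \<gamma> n)"
    using codim_dual_lower[OF assms] by (simp only: of_nat_le_iff)
  then show "1 * real n powr 0 * 4 ^ n \<le> real (codim_dual \<gamma> n)"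
    using \<open>n \<ge> 1\<close> by simp
qed

end
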